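(* Let $\tilde\omega_k$ be the unnormalised nonlinear weights of a WENO scheme that has $r$ substencils $S_0,\dots,S_{r-1}$ and satisfies $\frac{\tilde\omega_k}{\tilde\omega_l}\to\frac{\gamma_k}{\gamma_l}$ as $\Delta x\to0$ whenever $S_k$ and $S_l$ are smooth. Let the unnormalised embedded WENO weights be given by $$\tilde\omega_k^{(\mathrm E)}=\tilde\omega_k\left(1+\left(\frac{\left|\sum_{l=0}^{r-1}a_{kl}\,\beta_l\right|}{\beta_k+\varepsilon}\right)^p\right),\qquad k=0,1,\dots,r-1,$$ with $p\ge1$ and coefficients $a_{kl}$. Let $K$ be the set of indices such that $\beta_n=\mathcal O(1)$ for $n\in K$, i.e. $S_n$ is not smooth, and let $\beta_k\downarrow0$ for $k\notin K$ as $\Delta x\to0$. Then the embedding equations are given by $$\left(\frac{\gamma_k}{\alpha_k^{(K)}}\right)^{\frac1p}\sum_{m\in K}a_{km}=\pm\left(\frac{\gamma_l}{\alpha_l^{(K)}}\right)^{\frac1p}\sum_{n\in K}a_{ln},$$ with $k,l\notin K$ and $n,m\in K$. Here $\alpha_k^{(K)}$ are the desired inner weights and $\gamma_k$ the linear weights.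
   Context: A WENO scheme on a grid of size $\Delta x$ interpolates a function $u$ at a cell interface by combining the lower-order interpolations on $r$ substencils $S_0,\dots,S_{r-1}$ of a larger stencil, using nonlinear weights $\omega_k=\tilde\omega_k/\sum_l\tilde\omega_l$ obtained by normalising the unnormalised nonlinear weights $\tilde\omega_k$. The linear (optimal) weights $\gamma_k$ are the constants whose linear combination of the substencil interpolations gives the high-order approximation on the full stencil. The smoothness indicator $\beta_k$ of $S_k$ measures how rapidly the interpolation on $S_k$ varies; for the five-point scheme ($r=3$) it is the Jiang–Shu indicator $\beta_k=\int_{x_{j-1/2}}^{x_{j+1/2}}\left[(q_k''(x))^2\Delta x^3+(q_k'(x))^2\Delta x\right]dx$, where $q_k$ is the polynomial on $S_k$ with the same cell averages as $u$. A substencil is called smooth when the solution is smooth on it; when it contains a discontinuity its indicator is large, written $\beta_n=\mathcal O(1)$, in contrast to $\mathcal O(\Delta x^2)$ on a smooth substencil. Smooth substencils are taken to be without critical points, so that $\beta_l/\beta_k=1+\mathcal O(\Delta x^s)$ with $s\ge2$ for $S_k,S_l$ smooth. The constant $\varepsilon$ is a small constant that avoids division by zero, assumed so small that it may be ignored in the analysis. The $a_{kl}$ are undetermined coefficients. The inner weights $\alpha_k^{(K)}$, $k\notin K$, are chosen by the user: they are the weights the embedded scheme should produce on the smooth substencils when the substencils $S_n$, $n\in K$, are not smooth. The embedding equations are the equations for the coefficients $a_{kl}$ obtained by requiring that, as $\Delta x\downarrow0$, the ratio $\omega_k^{(\mathrm E)}/\omega_l^{(\mathrm E)}=\tilde\omega_k^{(\mathrm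 E)}/\tilde\omega_l^{(\mathrm E)}$ of embedded weights on smooth substencils equals the ratio $\alpha_k^{(K)}/\alpha_l^{(K)}$ of inner weights. The sign $\pm$ reflects a freedom of choice: because of the absolute value in the weights, any row of the matrix $(a_{kl})$ may be multiplied by $-1$.
   Formalization: The formal statement assumes the indicators of all non-smooth substencils are asymptotically equal (β_m/β_n→1 for m,n∈K), and asserts that the equation implies the ratio requirement only if at least one of the two coefficient sums is nonzero; without these the claim fails. *)

theory Defs
  imports Complex_Main "HOL-Library.Landau_Symbols"
begin

text \<open>
  Grid-dependent quantities are functions of the grid size \<open>h\<close> (the paper's \<open>\<Delta>x\<close>), and all limits
  are taken along \<open>at_right 0\<close>. A family of weights or of smoothness indicators is indexed by the
  substencil first, so \<open>\<beta> k h\<close> is the indicator of \<open>S\<^sub>k\<close> on the grid of size \<open>h\<close>.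
  The exponent \<open>p\<close> is any real number, hence \<open>powr\<close>; its base below is nonnegative whenever
  \<open>\<beta> k h + \<epsilon> h > 0\<close>, and \<open>0 powr p = 0\<close>.
\<close>

definition embedded_weight ::
  "nat \<Rightarrow> real \<Rightarrow> (nat \<Rightarrow> nat \<Rightarrow> real) \<Rightarrow> (real \<Rightarrow> real) \<Rightarrow> (nat \<Rightarrow> real \<Rightarrow> real) \<Rightarrow>
    (nat \<Rightarrow> real \<Rightarrow> real) \<Rightarrow> nat \<Rightarrow> real \<Rightarrow> real"
where
  "embedded_weight r p a \<epsilon> \<beta> \<omega> k h =
     \<omega> k h * (1 + (\<bar>\<Sum>l<r. a k l * \<beta> l h\<bar> / (\<beta> k h + \<epsilon> h)) powr p)"

definition normalised_weight ::
  "nat \<Rightarrow> (nat \<Rightarrow> real \<Rightarrow> real) \<Rightarrow> nat \<Rightarrow> real \<Rightarrow> real"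
where
  "normalised_weight r \<omega> k h = \<omega> k h / (\<Sum>l<r. \<omega> l h)"

text \<open>
  The requirement on the pair \<open>k\<close>, \<open>l\<close> from which the embedding equation is derived: the ratio of the
  (normalised) embedded weights tends to the ratio of the inner weights \<open>\<alpha> K\<close>.
\<close>

definition embedding_requirement ::
  "nat \<Rightarrow> real \<Rightarrow> (nat \<Rightarrow> nat \<Rightarrow> real) \<Rightarrow> (real \<Rightarrow> real) \<Rightarrow> (nat \<Rightarrow> real \<Rightarrow> real) \<Rightarrow>
    (nat \<Rightarrow> real \<Rightarrow> real) \<Rightarrow> (nat set \<Rightarrow> nat \<Rightarrow> real) \<Rightarrow> nat set \<Rightarrow> nat \<Rightarrow> nat \<Rightarrow> bool"
where
  "embedding_requirement r p a \<epsilon> \<beta> \<omega> \<alpha> K k l \<longleftrightarrow>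
     ((\<lambda>h. normalised_weight r (embedded_weight r p a \<epsilon> \<beta> \<omega>) k h /
           normalised_weight r (embedded_weight r p a \<epsilon> \<beta> \<omega>) l h)
        \<longlongrightarrow> \<alpha> K k / \<alpha> K l) (at_right 0)"

text \<open>
  The sign \<open>\<plusminus>\<close> is a disjunction, with the sign allowed to depend on the pair \<open>k\<close>, \<open>l\<close>.
\<close>

definition embedding_equation ::
  "real \<Rightarrow> (nat \<Rightarrow> nat \<Rightarrow> real) \<Rightarrow> (nat \<Rightarrow> real) \<Rightarrow> (nat set \<Rightarrow> nat \<Rightarrow> real) \<Rightarrow>
    nat set \<Rightarrow> nat \<Rightarrow> nat \<Rightarrow> bool"
where
  "embedding_equation p a \<gamma> \<alpha> K k l \<longleftrightarrow>
     (\<gamma> k / \<alpha> K k) powr (1 / p) * (\<Sum>m\<in>K. a k m) =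
       (\<gamma> l / \<alpha> K l) powr (1 / p) * (\<Sum>n\<in>K. a l n) \<or>
     (\<gamma> k / \<alpha> K k) powr (1 / p) * (\<Sum>m\<in>K. a k m) =
       - ((\<gamma> l / \<alpha> K l) powr (1 / p) * (\<Sum>n\<in>K. a l n))"

end

theory Submission imports Defs begin

text \<open>
  Write \<open>A\<^sub>k = (\<Sum>m\<in>K. a k m)\<close>. If \<open>K\<close> is empty then every \<open>A\<^sub>k\<close> vanishes and the equation reads
  \<open>0 = 0\<close>; so fix a nonsmooth substencil \<open>S\<^sub>n\<close> and a smooth one \<open>S\<^sub>j\<close>. Divided by \<open>\<beta> n\<close>, the
  numerator \<open>\<Sum>l<r. a k l * \<beta> l\<close> tends to \<open>A\<^sub>k\<close>: the nonsmooth indicators are all asymptotic to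
  \<open>\<beta> n\<close>, and the smooth ones are negligible (\<open>tendsto_linear_combination_over_dominant\<close>). The denominator
  \<open>\<beta> k + \<epsilon>\<close> is asymptotic to \<open>\<beta> j\<close> for every smooth \<open>k\<close>. Hence the factor by which the embedding
  multiplies \<open>\<omega> k\<close>, divided by the scale \<open>(\<bar>\<beta> n\<bar> / \<beta> j) powr p\<close> that is the same for all smooth
  substencils, tends to \<open>\<bar>A\<^sub>k\<bar> powr p\<close> (\<open>tendsto_scaled_embedding_factor\<close>).

  In the quotient of two embedded weights the common scale cancels, so when \<open>A\<^sub>l \<noteq> 0\<close> it tends to
  \<open>(\<gamma> k * \<bar>A\<^sub>k\<bar> powr p) / (\<gamma> l * \<bar>A\<^sub>l\<bar> powr p)\<close> (\<open>tendsto_ratio_common_scale\<close>).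
  By uniqueness of limits the requirement says that this number is \<open>\<alpha> K k / \<alpha> K l\<close>, which after
  taking \<open>p\<close>-th roots is the embedding equation up to sign (\<open>embedding_equation_iff_powr\<close>). When
  only \<open>A\<^sub>k \<noteq> 0\<close>, the roles of \<open>k\<close> and \<open>l\<close> are exchanged, since both the requirement and the
  equation are symmetric. When both vanish the equation is trivially true, whereas the scale then
  says nothing about the quotient of the weights; this is why the converse needs
  \<open>A\<^sub>k \<noteq> 0\<close> or \<open>A\<^sub>l \<noteq> 0\<close>.
\<close>

text \<open>
  Only indicators of the order of \<open>\<beta> n\<close> survive the division by \<open>\<beta> n\<close>, each with limit \<open>1\<close>.
\<close>

lemma tendsto_linear_combination_over_dominant:
  fixes f :: "'i \<Rightarrow> 'b \<Rightarrow> real" and c :: "'i \<Rightarrow> real"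
  assumes "finite I" "K \<subseteq> I"
    and dominant: "\<And>m. m \<in> K \<Longrightarrow> ((\<lambda>h. f m h / f n h) \<longlongrightarrow> 1) F"
    and negligible: "\<And>l. l \<in> I - K \<Longrightarrow> ((\<lambda>h. f l h / f n h) \<longlongrightarrow> 0) F"
  shows "((\<lambda>h. (\<Sum>l\<in>I. c l * f l h) / f n h) \<longlongrightarrow> (\<Sum>m\<in>K. c m)) F"
proof -
  have "((\<lambda>h. \<Sum>l\<in>I. c l * (f l h / f n h)) \<longlongrightarrow> (\<Sum>l\<in>I. c l * (if l \<in> K then 1 else 0))) F"
    by (intro tendsto_sum tendsto_mult tendsto_const) (auto intro: dominant negligible)
  moreover have "(\<Sum>l\<in>I. c l * (if l \<in> K then 1 else 0)) = (\<Sum>m\<in>K. c m)"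
    using assms(1,2) by (simp add: if_distrib sum.If_cases Int_absorb1 cong: if_cong)
  ultimately show ?thesis
    by (simp add: sum_divide_distrib)
qed

text \<open>
  Here \<open>N\<close> plays the numerator in the embedded weight of \<open>S\<^sub>k\<close>, \<open>b\<close> its own indicator, \<open>d\<close> a
  nonsmooth indicator and \<open>g\<close> the indicator of a smooth reference substencil. The scale is taken as
  \<open>(g / \<bar>d\<bar>) powr p\<close>, which tends to \<open>0\<close>, so that it also absorbs the summand \<open>1\<close>.
\<close>

lemma tendsto_scaled_embedding_factor:
  fixes N b d e g :: "'b \<Rightarrow> real"
  assumes p: "p > 0"
    and numerator: "((\<lambda>h. N h / d h) \<longlongrightarrow> A) F"
    and d_nz: "\<forall>\<^sub>F h in F. d h \<noteq> 0"
    and b_pos: "\<forall>\<^sub>F h in F. b h > 0" and g_pos: "\<forall>\<^sub>F h in F. g h > 0"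
    and e_small: "((\<lambda>h. e h / b h) \<longlongrightarrow> 0) F"
    and same_order: "((\<lambda>h. g h / b h) \<longlongrightarrow> 1) F"
    and g_small: "((\<lambda>h. g h / d h) \<longlongrightarrow> 0) F"
  shows "((\<lambda>h. (1 + (\<bar>N h\<bar> / (b h + e h)) powr p) * (g h / \<bar>d h\<bar>) powr p) \<longlongrightarrow> \<bar>A\<bar> powr p) F"
proof -
  have "((\<lambda>h. \<bar>g h / d h\<bar>) \<longlongrightarrow> 0) F"
    by (intro tendsto_rabs_zero g_small)
  moreover have "\<forall>\<^sub>F h in F. \<bar>g h / d h\<bar> = g h / \<bar>d h\<bar>"
    using g_pos by eventually_elim (simp add: abs_divide)
  ultimately have "((\<lambda>h. g h / \<bar>d h\<bar>) \<longlongrightarrow> 0) F"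
    by (rule Lim_transform_eventually)
  moreover have scale_nonneg: "\<forall>\<^sub>F h in F. 0 \<le> g h / \<bar>d h\<bar>"
    using g_pos by eventually_elim simp
  ultimately have scale: "((\<lambda>h. (g h / \<bar>d h\<bar>) powr p) \<longlongrightarrow> 0) F"
    using tendsto_powr'[of "\<lambda>h. g h / \<bar>d h\<bar>" 0 F "\<lambda>_. p" p] p by simp

  have "\<forall>\<^sub>F h in F. e h / b h > -1"
    using e_small by (rule order_tendstoD) simp
  with b_pos have denom_pos: "\<forall>\<^sub>F h in F. b h + e h > 0"
    by eventually_elim (simp add: field_simps)
  have "((\<lambda>h. \<bar>N h / d h\<bar> * (g h / b h) / (1 + e h / b h)) \<longlongrightarrow> \<bar>A\<bar> * 1 / (1 + 0)) F"
    by (intro tendsto_intros numerator same_order e_small) simp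
  moreover have "\<forall>\<^sub>F h in F. \<bar>N h / d h\<bar> * (g h / b h) / (1 + e h / b h)
      = (\<bar>N h\<bar> / (b h + e h)) * (g h / \<bar>d h\<bar>)"
    using b_pos denom_pos d_nz by eventually_elim (simp add: field_simps abs_divide)
  ultimately have "((\<lambda>h. (\<bar>N h\<bar> / (b h + e h)) * (g h / \<bar>d h\<bar>)) \<longlongrightarrow> \<bar>A\<bar> * 1 / (1 + 0)) F"
    by (rule Lim_transform_eventually)
  then have base: "((\<lambda>h. (\<bar>N h\<bar> / (b h + e h)) * (g h / \<bar>d h\<bar>)) \<longlongrightarrow> \<bar>A\<bar>) F"
    by simp
  have base_nonneg: "\<forall>\<^sub>F h in F. 0 \<le> (\<bar>N h\<bar> / (b h + e h)) * (g h / \<bar>d h\<bar>)"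
    using denom_pos g_pos by eventually_elim simp
  have "((\<lambda>h. ((\<bar>N h\<bar> / (b h + e h)) * (g h / \<bar>d h\<bar>)) powr p) \<longlongrightarrow> \<bar>A\<bar> powr p) F"
    using tendsto_powr'[OF base tendsto_const[of p]] base_nonneg p by simp
  from tendsto_add[OF scale this]
  have "((\<lambda>h. (g h / \<bar>d h\<bar>) powr p + ((\<bar>N h\<bar> / (b h + e h)) * (g h / \<bar>d h\<bar>)) powr p)
      \<longlongrightarrow> \<bar>A\<bar> powr p) F"
    by simp
  moreover have "\<forall>\<^sub>F h in F.
      (g h / \<bar>d h\<bar>) powr p + ((\<bar>N h\<bar> / (b h + e h)) * (g h / \<bar>d h\<bar>)) powr p
      = (1 + (\<bar>N h\<bar> / (b h + e h)) powr p) * (g h / \<bar>d h\<bar>) powr p"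
    using denom_pos scale_nonneg
  proof eventually_elim
    case (elim h)
    then have "0 \<le> \<bar>N h\<bar> / (b h + e h)" by simp
    with elim show ?case by (simp only: powr_mult distrib_right mult_1_left)
  qed
  ultimately show ?thesis
    by (rule Lim_transform_eventually)
qed

lemma tendsto_ratio_common_scale:
  fixes w\<^sub>1 w\<^sub>2 u\<^sub>1 u\<^sub>2 t :: "'b \<Rightarrow> real"
  assumes "((\<lambda>h. w\<^sub>1 h / w\<^sub>2 h) \<longlongrightarrow> c) F"
    and "((\<lambda>h. u\<^sub>1 h * t h) \<longlongrightarrow> x) F" "((\<lambda>h. u\<^sub>2 h * t h) \<longlongrightarrow> y) F"
    and "\<forall>\<^sub>F h in F. t h \<noteq> 0" "y \<noteq> 0"
  shows "((\<lambda>h. (w\<^sub>1 h * u\<^sub>1 h) / (w\<^sub>2 h * u\<^sub>2 h)) \<longlongrightarrow> c * (x / y)) F"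
proof -
  have "((\<lambda>h. (w\<^sub>1 h / w\<^sub>2 h) * ((u\<^sub>1 h * t h) / (u\<^sub>2 h * t h))) \<longlongrightarrow> c * (x / y)) F"
    using assms by (intro tendsto_intros)
  moreover have "\<forall>\<^sub>F h in F. (w\<^sub>1 h / w\<^sub>2 h) * ((u\<^sub>1 h * t h) / (u\<^sub>2 h * t h))
      = (w\<^sub>1 h * u\<^sub>1 h) / (w\<^sub>2 h * u\<^sub>2 h)"
    using assms(4) by eventually_elim simp
  ultimately show ?thesis
    by (rule Lim_transform_eventually)
qed

lemma tendsto_iff_eq_limit:
  fixes f :: "'b \<Rightarrow> 'c::t2_space"
  assumes "(f \<longlongrightarrow> x) F" "F \<noteq> bot"
  shows "(f \<longlongrightarrow> y) F \<longleftrightarrow> x = y"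
  using assms tendsto_unique by blast

lemma embedding_requirement_iff_unnormalised:
  assumes "\<forall>\<^sub>F h in at_right 0. (\<Sum>l<r. embedded_weight r p a \<epsilon> \<beta> \<omega> l h) \<noteq> 0"
  shows "embedding_requirement r p a \<epsilon> \<beta> \<omega> \<alpha> K k l \<longleftrightarrow>
    ((\<lambda>h. embedded_weight r p a \<epsilon> \<beta> \<omega> k h / embedded_weight r p a \<epsilon> \<beta> \<omega> l h)
      \<longlongrightarrow> \<alpha> K k / \<alpha> K l) (at_right 0)"
  unfolding embedding_requirement_def
proof (rule tendsto_cong)
  show "\<forall>\<^sub>F h in at_right 0.
      normalised_weight r (embedded_weight r p a \<epsilon> \<beta> \<omega>) k h /
        normalised_weight r (embedded_weight r p a \<epsilon> \<beta> \<omega>) l h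
      = embedded_weight r p a \<epsilon> \<beta> \<omega> k h / embedded_weight r p a \<epsilon> \<beta> \<omega> l h"
    using assms by eventually_elim (simp add: normalised_weight_def)
qed

lemma embedding_requirement_commute:
  assumes "\<alpha> K k > 0" "\<alpha> K l > 0"
  shows "embedding_requirement r p a \<epsilon> \<beta> \<omega> \<alpha> K k l \<longleftrightarrow> embedding_requirement r p a \<epsilon> \<beta> \<omega> \<alpha> K l k"
proof -
  have "embedding_requirement r p a \<epsilon> \<beta> \<omega> \<alpha> K l k"
    if "embedding_requirement r p a \<epsilon> \<beta> \<omega> \<alpha> K k l" "\<alpha> K k > 0" "\<alpha> K l > 0" for k l
    using that tendsto_inverse unfolding embedding_requirement_def
    by (fastforce simp: inverse_eq_divide)
  with assms show ?thesis by blast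
qed

lemma embedding_equation_commute:
  "embedding_equation p a \<gamma> \<alpha> K k l \<longleftrightarrow> embedding_equation p a \<gamma> \<alpha> K l k"
  unfolding embedding_equation_def by linarith

text \<open>
  The two signs together say that the absolute values agree, and \<open>x \<mapsto> x powr p\<close> is injective on
  nonnegative numbers.
\<close>

lemma embedding_equation_iff_powr:
  assumes p: "p > 0"
    and pos: "\<gamma> k > 0" "\<gamma> l > 0" "\<alpha> K k > 0" "\<alpha> K l > 0"
  shows "embedding_equation p a \<gamma> \<alpha> K k l \<longleftrightarrow>
    \<gamma> k / \<alpha> K k * \<bar>\<Sum>m\<in>K. a k m\<bar> powr p = \<gamma> l / \<alpha> K l * \<bar>\<Sum>m\<in>K. a l m\<bar> powr p"
proof -
  define side where "side i = (\<gamma> i / \<alpha> K i) powr (1 / p) * (\<Sum>m\<in>K. a i m)" for i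
  have side_powr: "\<bar>side i\<bar> powr p = \<gamma> i / \<alpha> K i * \<bar>\<Sum>m\<in>K. a i m\<bar> powr p"
    if "\<gamma> i > 0" "\<alpha> K i > 0" for i
    using that p by (simp add: side_def abs_mult powr_mult powr_powr)
  have "embedding_equation p a \<gamma> \<alpha> K k l \<longleftrightarrow> \<bar>side k\<bar> = \<bar>side l\<bar>"
    by (simp add: embedding_equation_def side_def abs_eq_iff)
  also have "\<dots> \<longleftrightarrow> \<bar>side k\<bar> powr p = \<bar>side l\<bar> powr p"
    using p powr_less_mono2[of p "\<bar>side k\<bar>" "\<bar>side l\<bar>"] powr_less_mono2[of p "\<bar>side l\<bar>" "\<bar>side k\<bar>"]
    by (metis abs_ge_zero less_irrefl linorder_neqE_linordered_idom)
  finally show ?thesis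
    using side_powr pos by simp
qed

theorem theorem2:
  fixes r :: nat and p s :: real
    and \<beta> \<omega> :: "nat \<Rightarrow> real \<Rightarrow> real" and \<epsilon> :: "real \<Rightarrow> real"
    and a :: "nat \<Rightarrow> nat \<Rightarrow> real"
    and \<gamma> :: "nat \<Rightarrow> real" and \<alpha> :: "nat set \<Rightarrow> nat \<Rightarrow> real"
    and K :: "nat set"
  assumes p: "p \<ge> 1"
    and K: "K = {n. n < r \<and> \<beta> n \<in> \<Theta>[at_right 0](\<lambda>_. 1)}"
    and beta_nonsmooth: "\<And>m n. m \<in> K \<Longrightarrow> n \<in> K \<Longrightarrow>
           ((\<lambda>h. \<beta> m h / \<beta> n h) \<longlongrightarrow> 1) (at_right 0)"
    and beta_smooth: "\<And>k. k < r \<Longrightarrow> k \<notin> K \<Longrightarrow> filterlim (\<beta> k) (at_right 0) (at_right 0)"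
    and s: "s \<ge> 2"
    and beta_ratio: "\<And>k l. k < r \<Longrightarrow> l < r \<Longrightarrow> k \<notin> K \<Longrightarrow> l \<notin> K \<Longrightarrow>
           (\<lambda>h. \<beta> l h / \<beta> k h - 1) \<in> O[at_right 0](\<lambda>h. h powr s)"
    and eps: "\<And>k. k < r \<Longrightarrow> k \<notin> K \<Longrightarrow> \<epsilon> \<in> o[at_right 0](\<beta> k)"
    and gamma: "\<And>k. k < r \<Longrightarrow> k \<notin> K \<Longrightarrow> \<gamma> k > 0"
    and alpha: "\<And>k. k < r \<Longrightarrow> k \<notin> K \<Longrightarrow> \<alpha> K k > 0"
    and weno: "\<And>k l. k < r \<Longrightarrow> l < r \<Longrightarrow> k \<notin> K \<Longrightarrow> l \<notin> K \<Longrightarrow>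
           ((\<lambda>h. \<omega> k h / \<omega> l h) \<longlongrightarrow> \<gamma> k / \<gamma> l) (at_right 0)"
    and normalisable: "\<forall>\<^sub>F h in at_right 0. (\<Sum>l<r. embedded_weight r p a \<epsilon> \<beta> \<omega> l h) \<noteq> 0"
  shows "\<forall>k<r. \<forall>l<r. k \<notin> K \<longrightarrow> l \<notin> K \<longrightarrow>
     (embedding_requirement r p a \<epsilon> \<beta> \<omega> \<alpha> K k l \<longrightarrow> embedding_equation p a \<gamma> \<alpha> K k l) \<and>
     ((\<Sum>m\<in>K. a k m) \<noteq> 0 \<or> (\<Sum>m\<in>K. a l m) \<noteq> 0 \<longrightarrow>
       (embedding_requirement r p a \<epsilon> \<beta> \<omega> \<alpha> K k l \<longleftrightarrow> embedding_equation p a \<gamma> \<alpha> K k l))"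
proof (cases "K = {}")
  case True
  then show ?thesis
    by (simp add: embedding_equation_def)
next
  case False
  then obtain n where n: "n \<in> K" by blast
  have p_pos: "p > 0" using p by simp
  let ?F = "at_right (0::real)"
  let ?W = "embedded_weight r p a \<epsilon> \<beta> \<omega>"
  let ?A = "\<lambda>k. \<Sum>m\<in>K. a k m"

  have n_big: "(\<lambda>_. 1) \<in> O[?F](\<beta> n)"
    using n bigthetaD2[of "\<beta> n" ?F "\<lambda>_. 1"] unfolding K bigomega_iff_bigo by blast
  have n_nz: "\<forall>\<^sub>F h in ?F. \<beta> n h \<noteq> 0"
  proof -
    from landau_o.bigE[OF n_big] obtain c where "\<forall>\<^sub>F h in ?F. norm (1::real) \<le> c * norm (\<beta> n h)"
      by blast
    then show ?thesis by eventually_elim auto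
  qed
  have smooth_pos: "\<forall>\<^sub>F h in ?F. \<beta> k h > 0" and smooth_small: "((\<lambda>h. \<beta> k h / \<beta> n h) \<longlongrightarrow> 0) ?F"
    if "k < r" "k \<notin> K" for k
  proof -
    from beta_smooth[OF that] have lim: "(\<beta> k \<longlongrightarrow> 0) ?F" and pos: "\<forall>\<^sub>F h in ?F. \<beta> k h > 0"
      by (auto simp: filterlim_at elim: eventually_mono)
    show "\<forall>\<^sub>F h in ?F. \<beta> k h > 0" by (rule pos)
    have "\<beta> k \<in> o[?F](\<lambda>_. 1)"
      using lim by (intro smalloI_tendsto) auto
    then have "\<beta> k \<in> o[?F](\<beta> n)"
      using n_big by (rule landau_o.small_big_trans)
    then show "((\<lambda>h. \<beta> k h / \<beta> n h) \<longlongrightarrow> 0) ?F"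
      by (rule smalloD_tendsto)
  qed
  have numerator: "((\<lambda>h. (\<Sum>i<r. a k i * \<beta> i h) / \<beta> n h) \<longlongrightarrow> ?A k) ?F" for k
    using K n beta_nonsmooth smooth_small
    by (intro tendsto_linear_combination_over_dominant) auto
  have smooth_ratio: "((\<lambda>h. \<beta> j h / \<beta> k h) \<longlongrightarrow> 1) ?F"
    if "k < r" "k \<notin> K" "j < r" "j \<notin> K" for j k
  proof -
    have "\<forall>\<^sub>F h::real in ?F. 0 \<le> h"
      using eventually_at_right_less by (rule eventually_mono) simp
    then have "((\<lambda>h::real. h powr s) \<longlongrightarrow> 0) ?F"
      using s tendsto_powr'[of "\<lambda>h::real. h" 0 ?F "\<lambda>_. s" s] by simp
    then have "(\<lambda>h::real. h powr s) \<in> o[?F](\<lambda>_. 1)"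
      by (intro smalloI_tendsto) auto
    with beta_ratio[of k j] that have "(\<lambda>h. \<beta> j h / \<beta> k h - 1) \<in> o[?F](\<lambda>_. 1)"
      using landau_o.big_small_trans by blast
    then have "((\<lambda>h. \<beta> j h / \<beta> k h - 1) \<longlongrightarrow> 0) ?F"
      by (auto dest: smalloD_tendsto)
    then show ?thesis
      by (simp add: LIM_zero_iff)
  qed

  have nondegenerate: "embedding_requirement r p a \<epsilon> \<beta> \<omega> \<alpha> K k l \<longleftrightarrow> embedding_equation p a \<gamma> \<alpha> K k l"
    if k: "k < r" "k \<notin> K" and l: "l < r" "l \<notin> K" and "?A l \<noteq> 0" for k l
  proof -
    \<comment> \<open>\<open>S\<^sub>l\<close> is its own reference: the scale need only be common to \<open>k\<close> and \<open>l\<close>.\<close>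
    have factor: "((\<lambda>h. (1 + (\<bar>\<Sum>j<r. a i j * \<beta> j h\<bar> / (\<beta> i h + \<epsilon> h)) powr p)
        * (\<beta> l h / \<bar>\<beta> n h\<bar>) powr p) \<longlongrightarrow> \<bar>?A i\<bar> powr p) ?F"
      if i: "i < r" "i \<notin> K" for i
      using smalloD_tendsto[OF eps[OF i]]
      by (intro tendsto_scaled_embedding_factor p_pos numerator n_nz smooth_pos smooth_ratio
            smooth_small i l)
    have scale_nz: "\<forall>\<^sub>F h in ?F. (\<beta> l h / \<bar>\<beta> n h\<bar>) powr p \<noteq> 0"
      using smooth_pos[OF l] n_nz by eventually_elim simp
    have limit: "((\<lambda>h. ?W k h / ?W l h) \<longlongrightarrow> \<gamma> k / \<gamma> l * (\<bar>?A k\<bar> powr p / \<bar>?A l\<bar> powr p)) ?F"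
      unfolding embedded_weight_def
      using weno[of k l] k l \<open>?A l \<noteq> 0\<close>
      by (intro tendsto_ratio_common_scale[OF _ factor factor scale_nz]) auto
    have "embedding_requirement r p a \<epsilon> \<beta> \<omega> \<alpha> K k l
        \<longleftrightarrow> ((\<lambda>h. ?W k h / ?W l h) \<longlongrightarrow> \<alpha> K k / \<alpha> K l) ?F"
      by (rule embedding_requirement_iff_unnormalised[OF normalisable])
    also have "\<dots> \<longleftrightarrow> \<gamma> k / \<gamma> l * (\<bar>?A k\<bar> powr p / \<bar>?A l\<bar> powr p) = \<alpha> K k / \<alpha> K l"
      by (rule tendsto_iff_eq_limit[OF limit]) simp
    also have "\<dots> \<longleftrightarrow> \<gamma> k / \<alpha> K k * \<bar>?A k\<bar> powr p = \<gamma> l / \<alpha> K l * \<bar>?A l\<bar> powr p"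
      using gamma[OF k] gamma[OF l] alpha[OF k] alpha[OF l] \<open>?A l \<noteq> 0\<close>
      by (simp add: field_simps)
    also have "\<dots> \<longleftrightarrow> embedding_equation p a \<gamma> \<alpha> K k l"
      using embedding_equation_iff_powr p_pos gamma alpha k l by simp
    finally show ?thesis .
  qed

  have equivalence: "embedding_requirement r p a \<epsilon> \<beta> \<omega> \<alpha> K k l \<longleftrightarrow> embedding_equation p a \<gamma> \<alpha> K k l"
    if "k < r" "k \<notin> K" "l < r" "l \<notin> K" "?A k \<noteq> 0 \<or> ?A l \<noteq> 0" for k l
    using that nondegenerate[of k l] nondegenerate[of l k] alpha
      embedding_requirement_commute[of \<alpha> K k l] embedding_equation_commute[of p a \<gamma> \<alpha> K k l]
    by blast
  moreover have "embedding_equation p a \<gamma> \<alpha> K k l" if "?A k = 0" "?A l = 0" for k l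
    using that by (simp add: embedding_equation_def)
  ultimately show ?thesis by blast
qed

end
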